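(* Let $\bar n>0$ be an integer, let $\mathcal{H}_{\bar n}$ be the Hilbert space with orthonormal basis $\{|0\rangle,|1\rangle,\dots,|\bar n\rangle\}$, and let $\mathbf{a}_{\bar n}=\sum_{n=1}^{\bar n}\sqrt{n}\,|n-1\rangle\langle n|$ be the truncated annihilation operator on $\mathcal{H}_{\bar n}$. Consider any Lindblad equation on the density operators on $\mathcal{H}_{\bar n}$, $$\tfrac{d}{dt}\rho=-i[H,\rho]-\tfrac12\sum_k\left(L_k^\dagger L_k\rho+\rho L_k^\dagger L_k-2L_k\rho L_k^\dagger\right),$$ with $H$ self-adjoint and $(L_k)_k$ a finite family of linear operators on $\mathcal{H}_{\bar n}$, such that at least one of the operators $L_k$ is proportional to $\mathbf{a}_{\bar n}$ (with nonzero proportionality constant), and such that the equation has a full-rank equilibrium $\rho_\infty$. Then $V_{\mathrm{Bures}}(\rho)=\mathrm{Tr}(\rho_\infty G_\rho^2)$, where $G_\rho$ is the solution of $\rho_\infty G_\rho+G_\rho\rho_\infty=\rho-\rho_\infty$, is a strict Lyapunov function for this equation; hence the system globally converges to $\rho_\infty$, i.e. every solution starting from a density operator on $\mathcal{H}_{\bar n}$ tends to $\rho_\infty$ as $t\to+\infty$.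
   Context: A density operator is a self-adjoint, positive semi-definite operator of trace one; full rank means positive definite. $[A,B]=AB-BA$ and ${}^\dagger$ denotes the operator adjoint. Since $\rho_\infty$ is positive definite, $G_\rho$ is uniquely defined and Hermitian. Strict Lyapunov function means: $V_{\mathrm{Bures}}\ge 0$ with equality only at $\rho_\infty$, and along solutions $\tfrac{d}{dt}V_{\mathrm{Bures}}(\rho)\le 0$ with equality only when $\rho=\rho_\infty$. *)

theory Defs
  imports "HOL-Analysis.Analysis"
begin

text \<open>
  Operators on a finite-dimensional complex Hilbert space are represented by their matrices in a
  fixed orthonormal basis indexed by the finite type \<open>'n\<close>. The scalar multiplications that
  HOL-Analysis offers on matrices are real, hence the complex one below.
\<close>

definition cscale :: "complex \<Rightarrow> complex^'n^'n \<Rightarrow> complex^'n^'n"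
  where "cscale c A = (\<chi> i j. c * A $ i $ j)"

definition dagger :: "complex^'n^'n \<Rightarrow> complex^'n^'n"
  where "dagger A = (\<chi> i j. cnj (A $ j $ i))"

definition commutator :: "complex^'n^'n \<Rightarrow> complex^'n^'n \<Rightarrow> complex^'n^'n"
  where "commutator A B = A ** B - B ** A"

text \<open>
  The Hermitian inner product; the library's \<open>inner\<close> on \<open>complex^'n\<close> is its real part.
\<close>

definition cinner :: "complex^'n \<Rightarrow> complex^'n \<Rightarrow> complex"
  where "cinner x y = (\<Sum>i\<in>UNIV. cnj (x $ i) * y $ i)"

definition self_adjoint :: "complex^'n^'n \<Rightarrow> bool"
  where "self_adjoint A \<longleftrightarrow> dagger A = A"

text \<open>For self-adjoint \<open>A\<close> the number \<open>cinner x (A *v x)\<close> is real.\<close>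

definition pos_semidef :: "complex^'n^'n \<Rightarrow> bool"
  where "pos_semidef A \<longleftrightarrow> self_adjoint A \<and> (\<forall>x. Re (cinner x (A *v x)) \<ge> 0)"

definition pos_def :: "complex^'n^'n \<Rightarrow> bool"
  where "pos_def A \<longleftrightarrow> self_adjoint A \<and> (\<forall>x. x \<noteq> 0 \<longrightarrow> Re (cinner x (A *v x)) > 0)"

definition density_operator :: "complex^'n^'n \<Rightarrow> bool"
  where "density_operator \<rho> \<longleftrightarrow> pos_semidef \<rho> \<and> trace \<rho> = 1"

text \<open>
  The basis vectors of the truncated Hilbert space are labelled \<open>0, \<dots>, N\<close> through a bijection
  \<open>lev\<close> from the index type onto \<open>{0..N}\<close>; the operator \<open>ketbra lev m n\<close> is
  \<open>|m\<rangle>\<langle>n|\<close>, for levels \<open>m\<close> and \<open>n\<close>.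
\<close>

definition ketbra :: "('n \<Rightarrow> nat) \<Rightarrow> nat \<Rightarrow> nat \<Rightarrow> complex^'n^'n"
  where "ketbra lev m n = (\<chi> i j. if lev i = m \<and> lev j = n then 1 else 0)"

definition annihilation :: "('n \<Rightarrow> nat) \<Rightarrow> nat \<Rightarrow> complex^'n^'n"
  where "annihilation lev N =
    (\<Sum>n=1..N. cscale (complex_of_real (sqrt (real n))) (ketbra lev (n - 1) n))"

definition lindblad ::
    "complex^'n^'n \<Rightarrow> 'k set \<Rightarrow> ('k \<Rightarrow> complex^'n^'n) \<Rightarrow> complex^'n^'n \<Rightarrow> complex^'n^'n"
  where "lindblad H K L \<rho> =
    cscale (- \<i>) (commutator H \<rho>)
    - (1/2) *\<^sub>R (\<Sum>k\<in>K. dagger (L k) ** L k ** \<rho> + \<rho> ** (dagger (L k) ** L k)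
                       - 2 *\<^sub>R (L k ** \<rho> ** dagger (L k)))"

text \<open>
  A solution on \<open>[0, \<infinity>)\<close> starting from a density operator. That it stays among the density
  operators is a property of the Lindblad equation and is not part of the definition.
\<close>

definition density_solution ::
    "(complex^'n^'n \<Rightarrow> complex^'n^'n) \<Rightarrow> (real \<Rightarrow> complex^'n^'n) \<Rightarrow> bool"
  where "density_solution F \<rho> \<longleftrightarrow>
    density_operator (\<rho> 0) \<and>
    (\<forall>t\<ge>0. (\<rho> has_vector_derivative F (\<rho> t)) (at t within {0..}))"

text \<open>
  For positive definite \<open>\<rho>_inf\<close> the equation determines \<open>G\<close> uniquely, and \<open>G\<close>
  is self-adjoint when \<open>\<rho>\<close> is; the trace in \<open>V_Bures\<close> is then a real number.
\<close>

definition G_Bures :: "complex^'n^'n \<Rightarrow> complex^'n^'n \<Rightarrow> complex^'n^'n"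
  where "G_Bures \<rho>_inf \<rho> = (THE G. \<rho>_inf ** G + G ** \<rho>_inf = \<rho> - \<rho>_inf)"

definition V_Bures :: "complex^'n^'n \<Rightarrow> complex^'n^'n \<Rightarrow> real"
  where "V_Bures \<rho>_inf \<rho> =
    Re (trace (\<rho>_inf ** (G_Bures \<rho>_inf \<rho> ** G_Bures \<rho>_inf \<rho>)))"

definition strict_lyapunov ::
    "(complex^'n^'n \<Rightarrow> complex^'n^'n) \<Rightarrow> complex^'n^'n \<Rightarrow> (complex^'n^'n \<Rightarrow> real) \<Rightarrow> bool"
  where "strict_lyapunov F \<rho>_inf V \<longleftrightarrow>
    (\<forall>\<rho>. density_operator \<rho> \<longrightarrow> V \<rho> \<ge> 0 \<and> (V \<rho> = 0 \<longleftrightarrow> \<rho> = \<rho>_inf)) \<and>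
    (\<forall>\<rho>. density_solution F \<rho> \<longrightarrow>
      (\<forall>t\<ge>0. \<exists>D. ((\<lambda>s. V (\<rho> s)) has_real_derivative D) (at t within {0..}) \<and>
                D \<le> 0 \<and> (D = 0 \<longleftrightarrow> \<rho> t = \<rho>_inf)))"

end

theory Submission
  imports Defs
begin

text \<open>
  Write \<open>\<rho> - \<rho>_inf = \<rho>_inf G + G \<rho>_inf\<close>. The derivative of the Bures functional along a
  solution is \<open>Tr (G F(\<rho>_inf G + G \<rho>_inf))\<close>, with \<open>F\<close> the Lindblad map. Subtracting
  \<open>Tr (G\<^sup>2 F(\<rho>_inf)) = 0\<close> turns it into minus the sum of
  \<open>Tr (\<rho>_inf [L k, G]\<^sup>\<dagger> [L k, G])\<close>, so it is nonpositive, and it vanishes only if \<open>G\<close>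
  commutes with every \<open>L k\<close>. A self-adjoint matrix that commutes with the truncated annihilation
  operator is scalar, and \<open>2 Tr (\<rho>_inf G) = Tr (\<rho> - \<rho>_inf) = 0\<close> then forces \<open>G = 0\<close>. Only
  self-adjointness and the trace of \<open>\<rho>\<close> enter, so it is not necessary to show that the equation
  preserves positivity. By compactness of the unit sphere the dissipation dominates a positive multiple of the functional,
  which therefore decays exponentially.
\<close>

section \<open>Algebra of matrices: bilinearity, trace, adjoint\<close>

lemma matrix_mul_expand:
  fixes A B C :: "complex^'n^'n"
  shows "A ** (B + C) = A ** B + A ** C" "(A + B) ** C = A ** C + B ** C"
    "A ** (B - C) = A ** B - A ** C" "(A - B) ** C = A ** C - B ** C"
    "A ** (- B) = - (A ** B)" "(- A) ** B = - (A ** B)"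
    "(r *\<^sub>R A) ** B = r *\<^sub>R (A ** B)" "A ** (r *\<^sub>R B) = r *\<^sub>R (A ** B)"
    "cscale c A ** B = cscale c (A ** B)" "A ** cscale c B = cscale c (A ** B)"
    "(A ** B) ** C = A ** (B ** C)"
  by (simp_all add: matrix_mul_assoc)
    (simp_all add: matrix_matrix_mult_def vec_eq_iff cscale_def sum.distrib sum_subtractf
      sum_negf ring_distribs scaleR_sum_right sum_distrib_left mult_ac)

lemma trace_expand:
  fixes A B :: "complex^'n^'n"
  shows "trace (A + B) = trace A + trace B" "trace (A - B) = trace A - trace B"
    "trace (- A) = - trace A" "trace (r *\<^sub>R A) = of_real r * trace A"
    "trace (cscale c A) = c * trace A" "trace (0 :: complex^'n^'n) = 0"
  by (simp_all add: trace_def cscale_def sum.distrib sum_subtractf sum_negf scaleR_sum_right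
      sum_distrib_left scaleR_conv_of_real[where 'a = complex])

lemma dagger_expand:
  fixes A B :: "complex^'n^'n"
  shows "dagger (A + B) = dagger A + dagger B" "dagger (A - B) = dagger A - dagger B"
    "dagger (- A) = - dagger A" "dagger (r *\<^sub>R A) = r *\<^sub>R dagger A"
    "dagger (cscale c A) = cscale (cnj c) (dagger A)" "dagger (0 :: complex^'n^'n) = 0"
    "dagger (A ** B) = dagger B ** dagger A" "dagger (dagger A) = A"
  by (simp_all add: dagger_def cscale_def vec_eq_iff matrix_matrix_mult_def mult_ac)

lemma cscale_expand:
  fixes A B :: "complex^'n^'n"
  shows "cscale c (A + B) = cscale c A + cscale c B" "cscale c (A - B) = cscale c A - cscale c B"
    "cscale c (r *\<^sub>R A) = r *\<^sub>R cscale c A" "cscale (- c) A = - cscale c A"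
    "cscale c (- A) = - cscale c A"
  by (simp_all add: cscale_def vec_eq_iff ring_distribs)

lemma sum_matrix_mul_left:
  fixes B :: "complex^'n^'n" and A :: "'k \<Rightarrow> complex^'n^'n"
  shows "B ** (\<Sum>k\<in>K. A k) = (\<Sum>k\<in>K. B ** A k)"
  by (induction K rule: infinite_finite_induct) (simp_all add: matrix_mul_expand)

lemma trace_sum:
  fixes A :: "'k \<Rightarrow> complex^'n^'n"
  shows "trace (\<Sum>k\<in>K. A k) = (\<Sum>k\<in>K. trace (A k))"
  by (induction K rule: infinite_finite_induct) (simp_all add: trace_expand)

lemma dagger_sum:
  fixes A :: "'k \<Rightarrow> complex^'n^'n"
  shows "dagger (\<Sum>k\<in>K. A k) = (\<Sum>k\<in>K. dagger (A k))"
  by (induction K rule: infinite_finite_induct) (simp_all add: dagger_expand)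

lemma linear_dagger: "linear (dagger :: complex^'n^'n \<Rightarrow> _)"
  by (rule linearI) (simp_all add: dagger_expand)

lemma linear_trace: "linear (trace :: complex^'n^'n \<Rightarrow> _)"
  by (rule linearI) (simp_all add: trace_expand scaleR_conv_of_real[where 'a = complex])

lemma linear_matrix_mul_left: "linear (\<lambda>A :: complex^'n^'n. (B :: complex^'n^'n) ** A)"
  by (rule linearI) (simp_all add: matrix_mul_expand)

lemma bounded_bilinear_matrix_mul:
  "bounded_bilinear ((**) :: complex^'n^'n \<Rightarrow> complex^'n^'n \<Rightarrow> complex^'n^'n)"
  unfolding bilinear_conv_bounded_bilinear[symmetric] bilinear_def
  by (auto intro!: linearI simp: matrix_mul_expand)

section \<open>The Lindblad generator: compatibility with adjoint and trace, carre du champ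
  identity\<close>

definition dissipator :: "complex^'n^'n \<Rightarrow> complex^'n^'n \<Rightarrow> complex^'n^'n"
  where "dissipator L \<rho> = dagger L ** L ** \<rho> + \<rho> ** (dagger L ** L) - 2 *\<^sub>R (L ** \<rho> ** dagger L)"

lemma lindblad_dissipator:
  "lindblad H K L \<rho> = cscale (- \<i>) (commutator H \<rho>) - (1/2) *\<^sub>R (\<Sum>k\<in>K. dissipator (L k) \<rho>)"
  by (simp add: lindblad_def dissipator_def)

lemma linear_dissipator: "linear (dissipator L)"
  by (rule linearI) (simp_all add: dissipator_def matrix_mul_expand algebra_simps)

lemma linear_lindblad: "linear (lindblad H K L)"
  by (rule linearI) (simp_all add: lindblad_dissipator commutator_def matrix_mul_expand
      cscale_expand linear_add[OF linear_dissipator] linear_scale[OF linear_dissipator]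
      sum.distrib scaleR_sum_right algebra_simps)

lemma dissipator_dagger: "dissipator L (dagger \<rho>) = dagger (dissipator L \<rho>)"
  by (simp add: dissipator_def dagger_expand matrix_mul_expand)

lemma lindblad_dagger:
  assumes "self_adjoint H"
  shows "lindblad H K L (dagger \<rho>) = dagger (lindblad H K L \<rho>)"
  using assms by (simp add: lindblad_dissipator dagger_expand dagger_sum dissipator_dagger
      commutator_def self_adjoint_def cscale_expand)

lemma trace_lindblad: "trace (lindblad H K L \<rho>) = 0"
proof -
  have "trace (dissipator M \<rho>) = 0" for M
    using trace_mul_sym[of \<rho> "dagger M ** M"] trace_mul_sym[of "M ** \<rho>" "dagger M"]
    by (simp add: dissipator_def trace_expand matrix_mul_expand)
  then show ?thesis
    by (simp add: lindblad_dissipator trace_expand trace_sum commutator_def trace_mul_sym[of \<rho> H])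
qed

text \<open>Let \<open>D*\<close> be the dual of the dissipator under the trace pairing. By
  cyclicity the left side is the trace of \<open>\<sigma>\<close> times
  \<open>G D*(G) + D*(G) G - D*(G^2)\<close>, which measures how far \<open>D*\<close> is from a
  derivation. In this defect all terms cancel except twice the expanded square of the
  commutator.\<close>

lemma dissipator_carre_du_champ:
  assumes "dagger G = G"
  shows "trace (G ** dissipator L (\<sigma> ** G + G ** \<sigma>)) - trace (G ** G ** dissipator L \<sigma>)
    = 2 * trace (\<sigma> ** (dagger (commutator L G) ** commutator L G))"
  using assms
  by (simp add: dissipator_def commutator_def dagger_expand matrix_mul_expand trace_expand
      trace_mul_sym[of G] trace_mul_sym[of L] trace_mul_sym[of "dagger L"])

text \<open>Commutation with \<open>H\<close> is a derivation, so its carre du champ vanishes and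
  the Hamiltonian part adds nothing to the dissipation.\<close>

lemma hamiltonian_derivation:
  "trace (G ** commutator H (\<sigma> ** G + G ** \<sigma>)) = trace (G ** G ** commutator H \<sigma>)"
  by (simp add: commutator_def matrix_mul_expand trace_expand
      trace_mul_sym[of G] trace_mul_sym[of H])

lemma lindblad_carre_du_champ:
  assumes "dagger G = G"
  shows "trace (G ** lindblad H K L (\<sigma> ** G + G ** \<sigma>)) - trace (G ** G ** lindblad H K L \<sigma>)
    = - (\<Sum>k\<in>K. trace (\<sigma> ** (dagger (commutator (L k) G) ** commutator (L k) G)))"
proof -
  have "trace (G ** lindblad H K L (\<sigma> ** G + G ** \<sigma>)) - trace (G ** G ** lindblad H K L \<sigma>)
    = - (1/2) * (\<Sum>k\<in>K. trace (G ** dissipator (L k) (\<sigma> ** G + G ** \<sigma>))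
        - trace (G ** G ** dissipator (L k) \<sigma>))"
    using hamiltonian_derivation[of G H \<sigma>]
    by (simp add: lindblad_dissipator sum_matrix_mul_left trace_sum trace_expand sum_subtractf
        matrix_mul_expand(3,8,10) right_diff_distrib)
  also have "\<dots> = - (\<Sum>k\<in>K. trace (\<sigma> ** (dagger (commutator (L k) G) ** commutator (L k) G)))"
    by (simp add: dissipator_carre_du_champ[OF assms] flip: sum_distrib_left)
  finally show ?thesis .
qed

section \<open>The quadratic form weighted by the equilibrium\<close>

text \<open>For positive definite \<open>\<sigma>\<close> this is a squared Hilbert-Schmidt norm
  with weight \<open>\<sigma>\<close>. The Bures functional is its value at \<open>G\<close>, and
  the dissipation sums its values at the commutators.\<close>

definition weighted_form :: "complex^'n^'n \<Rightarrow> complex^'n^'n \<Rightarrow> real"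
  where "weighted_form \<sigma> A = Re (trace (\<sigma> ** (dagger A ** A)))"

text \<open>Cyclicity gives the trace of \<open>A ** \<sigma> ** dagger A\<close>, whose diagonal
  entries are values of the quadratic form of \<open>\<sigma>\<close>. Definiteness of
  \<open>\<sigma>\<close> thus passes to the form on matrices.\<close>

lemma weighted_form_columns:
  "weighted_form \<sigma> A
    = (\<Sum>i\<in>UNIV. Re (cinner (column i (dagger A)) (\<sigma> *v column i (dagger A))))"
proof -
  have "trace (\<sigma> ** (dagger A ** A)) = trace (A ** (\<sigma> ** dagger A))"
    by (simp add: trace_mul_sym[of A] matrix_mul_expand(11))
  also have "\<dots> = (\<Sum>i\<in>UNIV. cinner (column i (dagger A)) (\<sigma> *v column i (dagger A)))"
    by (simp add: cinner_def trace_def column_def dagger_def matrix_matrix_mult_def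
        matrix_vector_mult_def)
  finally show ?thesis
    by (simp add: weighted_form_def)
qed

lemma pos_def_nonneg: "pos_def \<sigma> \<Longrightarrow> Re (cinner x (\<sigma> *v x)) \<ge> 0"
  by (cases "x = 0") (auto simp: pos_def_def cinner_def less_imp_le)

lemma weighted_form_nonneg: "pos_def \<sigma> \<Longrightarrow> weighted_form \<sigma> A \<ge> 0"
  unfolding weighted_form_columns by (intro sum_nonneg pos_def_nonneg)

lemma weighted_form_eq_0:
  assumes "pos_def \<sigma>" and "weighted_form \<sigma> A = 0"
  shows "A = 0"
proof -
  have "Re (cinner (column i (dagger A)) (\<sigma> *v column i (dagger A))) = 0" for i
    using assms(2) pos_def_nonneg[OF assms(1)] unfolding weighted_form_columns
    by (subst (asm) sum_nonneg_eq_0_iff) auto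
  then have "column i (dagger A) = 0" for i
    using assms(1) unfolding pos_def_def by (metis less_irrefl)
  then show ?thesis
    by (simp add: column_def vec_eq_iff dagger_def)
qed

lemma weighted_form_0 [simp]: "weighted_form \<sigma> 0 = 0"
  by (simp add: weighted_form_def trace_expand)

lemma weighted_form_scaleR: "weighted_form \<sigma> (r *\<^sub>R A) = r\<^sup>2 * weighted_form \<sigma> A"
  by (simp add: weighted_form_def dagger_expand matrix_mul_expand trace_expand power2_eq_square)

lemma continuous_on_weighted_form:
  "continuous_on UNIV (weighted_form \<sigma>)"
proof -
  note cont = linear_continuous_on[OF linear_conv_bounded_linear[THEN iffD1],
      THEN continuous_on_compose2]
  show ?thesis
    unfolding weighted_form_def
    by (intro continuous_intros cont[OF linear_trace] cont[OF linear_matrix_mul_left]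
        bounded_bilinear.continuous_on[OF bounded_bilinear_matrix_mul] cont[OF linear_dagger]) auto
qed

section \<open>Analytic tools: a Gronwall inequality and comparison of quadratic quantities\<close>

text \<open>Multiplying by \<open>exp (- c * s)\<close> turns the differential inequality into
  monotonicity. It serves once with \<open>c = 2 * B\<close>, to show that solutions stay
  self-adjoint, and once with \<open>c = - (1 / C)\<close>, for the decay.\<close>

lemma gronwall_exp_bound:
  fixes f :: "real \<Rightarrow> real"
  assumes deriv: "\<And>s. s \<ge> 0 \<Longrightarrow> \<exists>D. (f has_real_derivative D) (at s within {0..}) \<and> D \<le> c * f s"
    and "t \<ge> 0"
  shows "f t \<le> f 0 * exp (c * t)"
proof -
  define g where "g s = f s * exp (- c * s)" for s
  have g: "\<exists>D. (g has_real_derivative D) (at s within {0..}) \<and> D \<le> 0" if "s \<ge> 0" for s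
  proof -
    obtain D where D: "(f has_real_derivative D) (at s within {0..})" "D \<le> c * f s"
      using deriv[OF \<open>s \<ge> 0\<close>] by blast
    have "(g has_real_derivative (D - c * f s) * exp (- c * s)) (at s within {0..})"
      unfolding g_def by (rule derivative_eq_intros D(1) refl)+ (simp add: algebra_simps)
    moreover have "(D - c * f s) * exp (- c * s) \<le> 0"
      using D(2) by (simp add: mult_nonpos_nonneg)
    ultimately show ?thesis by blast
  qed
  have "continuous_on {0..} g"
    unfolding continuous_on_eq_continuous_within using g DERIV_continuous by fastforce
  then have "continuous_on {0..t} g"
    by (rule continuous_on_subset) auto
  \<comment> \<open>At interior points the one-sided derivative is an ordinary one; at 0 continuity
    suffices.\<close>
  moreover have "\<exists>D. DERIV g s :> D \<and> D \<le> 0" if "0 < s" for s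
    using g[of s] that at_within_interior[of s "{0..}"] by simp
  ultimately have "g t \<le> g 0"
    using DERIV_nonpos_imp_decreasing_open[OF \<open>t \<ge> 0\<close>] by blast
  then have "f t * exp (- c * t) * exp (c * t) \<le> f 0 * exp (c * t)"
    by (intro mult_right_mono) (simp_all add: g_def)
  then show ?thesis
    by (simp add: mult.assoc flip: exp_add)
qed

text \<open>The ratio \<open>g x / f x\<close> is continuous on the compact unit sphere of
  \<open>E\<close>, hence bounded there, and homogeneity of degree two carries the bound to all of
  \<open>E\<close>.\<close>

lemma square_homogeneous_bound:
  fixes f g :: "'a::euclidean_space \<Rightarrow> real"
  assumes E: "subspace E" and "continuous_on UNIV f" "continuous_on UNIV g"
    and hom: "\<And>r x. f (r *\<^sub>R x) = r\<^sup>2 * f x" "\<And>r x. g (r *\<^sub>R x) = r\<^sup>2 * g x"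
    and pos: "\<And>x. x \<in> E \<Longrightarrow> x \<noteq> 0 \<Longrightarrow> f x > 0"
  obtains C where "C > 0" "\<And>x. x \<in> E \<Longrightarrow> g x \<le> C * f x"
proof -
  define S where "S = E \<inter> sphere 0 1"
  have S: "compact S"
    unfolding S_def by (intro closed_Int_compact closed_subspace E compact_sphere)
  have "\<exists>C>0. \<forall>x\<in>S. g x \<le> C * f x"
  proof -
    have "continuous_on S (\<lambda>x. g x / f x)"
      using pos by (intro continuous_on_divide continuous_on_subset[OF assms(2)]
          continuous_on_subset[OF assms(3)]) (force simp: S_def)+
    then have "bounded ((\<lambda>x. g x / f x) ` S)"
      using S compact_continuous_image compact_imp_bounded by blast
    then obtain C where "C > 0" "\<And>x. x \<in> S \<Longrightarrow> g x / f x \<le> C"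
      unfolding bounded_pos by (auto simp del: abs_divide dest: abs_le_D1)
    moreover have "f x > 0" if "x \<in> S" for x
      using that pos[of x] by (force simp: S_def)
    ultimately show ?thesis
      by (metis pos_divide_le_eq)
  qed
  then obtain C where C: "C > 0" "\<And>x. x \<in> S \<Longrightarrow> g x \<le> C * f x"
    by blast
  have "g x \<le> C * f x" if "x \<in> E" for x
  proof (cases "x = 0")
    case True
    then show ?thesis using hom[of 0 0] by simp
  next
    case False
    define u where "u = (1 / norm x) *\<^sub>R x"
    have "u \<in> S"
      using False that E by (simp add: S_def u_def subspace_scale)
    have x: "x = norm x *\<^sub>R u"
      using False by (simp add: u_def)
    have "g x = (norm x)\<^sup>2 * g u" "f x = (norm x)\<^sup>2 * f u"
      by (subst x, simp only: hom)+
    then show ?thesis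
      using mult_left_mono[OF C(2)[OF \<open>u \<in> S\<close>], of "(norm x)\<^sup>2"] by (simp add: mult_ac)
  qed
  with C(1) show thesis by (rule that)
qed

section \<open>Self-adjoint matrices commuting with the annihilation operator\<close>

lemma annihilation_entry:
  assumes "bij_betw lev UNIV {0..N}"
  shows "annihilation lev N $ i $ j
    = (if lev j = Suc (lev i) then complex_of_real (sqrt (real (lev j))) else 0)"
proof -
  have "lev j \<le> N"
    using assms by (metis UNIV_I atLeastAtMost_iff bij_betwE)
  \<comment> \<open>Column \<open>j\<close> selects the summand \<open>n = lev j\<close>. At level 0
    nothing is selected, in agreement with the claim, since 0 is not a successor.\<close>
  have "annihilation lev N $ i $ j
      = (\<Sum>n=1..N. if n = lev j
          then if lev j = Suc (lev i) then complex_of_real (sqrt (real n)) else 0 else 0)"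
    unfolding annihilation_def sum_component
    by (intro sum.cong) (auto simp: cscale_def ketbra_def)
  then show ?thesis
    using \<open>lev j \<le> N\<close> by (auto simp: sum.delta)
qed

lemma commutator_cscale_left: "commutator (cscale c A) B = cscale c (commutator A B)"
  by (simp add: commutator_def matrix_mul_expand cscale_expand)

lemma cscale_eq_0_iff: "cscale c A = 0 \<longleftrightarrow> c = 0 \<or> A = 0"
  by (auto simp: cscale_def vec_eq_iff)

text \<open>Comparing entries of the two products links neighbours along each diagonal. Below the
  main diagonal the recursion ends in column 0 with the value 0; self-adjointness reflects this to
  the upper triangle; on the main diagonal it makes all entries equal.\<close>

lemma commutes_annihilation_imp_scalar:
  fixes lev :: "'n::finite \<Rightarrow> nat"
  assumes lev: "bij_betw lev UNIV {0..N}"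
    and comm: "commutator (annihilation lev N) G = 0" and G: "dagger G = G"
  shows "\<exists>c. G = cscale c (mat 1)"
proof -
  define e where "e = inv lev"
  have inj: "inj lev" and range: "range lev = {0..N}"
    using lev by (auto simp: bij_betw_def)
  have e_lev [simp]: "e (lev i) = i" for i
    using inj by (simp add: e_def)
  have lev_e: "lev (e m) = m" if "m \<le> N" for m
    using that range unfolding e_def by (metis atLeastAtMost_iff f_inv_into_f zero_le)
  have lev_eq: "lev k = m \<longleftrightarrow> k = e m" if "m \<le> N" for k m
    using lev_e[OF that] by auto
  \<comment> \<open>Entry at levels \<open>m\<close>, \<open>n\<close> of the commutation relation.
    For \<open>n = 0\<close> the right side is 0 because column 0 of the annihilation operator
    vanishes; the truncated \<open>n - 1\<close> is then only a dummy index.\<close>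
  have step: "complex_of_real (sqrt (real (Suc m))) * G $ e (Suc m) $ e n
      = (if n = 0 then 0 else complex_of_real (sqrt (real n)) * G $ e m $ e (n - 1))"
    if "Suc m \<le> N" "n \<le> N" for m n
  proof -
    have "(annihilation lev N ** G) $ e m $ e n = (G ** annihilation lev N) $ e m $ e n"
      using comm by (simp add: commutator_def)
    moreover have "(annihilation lev N ** G) $ e m $ e n
        = (\<Sum>k\<in>UNIV. if k = e (Suc m) then complex_of_real (sqrt (real (Suc m))) * G $ k $ e n else 0)"
      unfolding matrix_matrix_mult_def vec_lambda_beta using that
      by (intro sum.cong refl) (auto simp: annihilation_entry[OF lev] lev_e lev_eq)
    moreover have "(G ** annihilation lev N) $ e m $ e n
        = (\<Sum>k\<in>UNIV. if k = e (n - 1) then if n = 0 then 0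
             else complex_of_real (sqrt (real n)) * G $ e m $ k else 0)"
      unfolding matrix_matrix_mult_def vec_lambda_beta using that
      by (intro sum.cong refl, cases n) (auto simp: annihilation_entry[OF lev] lev_e lev_eq)
    ultimately show ?thesis by simp
  qed
  have lower: "G $ e m $ e n = 0" if "n < m" "m \<le> N" for m n
    using that
  proof (induction n arbitrary: m)
    case 0
    then obtain m' where "m = Suc m'" by (cases m) auto
    then show ?case using step[of m' 0] 0 by simp
  next
    case (Suc n)
    then obtain m' where "m = Suc m'" by (cases m) auto
    then show ?case using step[of m' "Suc n"] Suc by simp
  qed
  have "cnj (G $ j $ i) = G $ i $ j" for i j
    using G by (auto simp: dagger_def vec_eq_iff)
  then have upper: "G $ e m $ e n = 0" if "m < n" "n \<le> N" for m n
    using lower[OF that] by (metis complex_cnj_zero)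
  \<comment> \<open>With \<open>n = Suc m\<close> both sides of \<open>step\<close> carry the same
    nonzero root, which cancels.\<close>
  have diag: "G $ e m $ e m = G $ e 0 $ e 0" if "m \<le> N" for m
    using that by (induction m) (use step in force)+
  have "G $ i $ j = cscale (G $ e 0 $ e 0) (mat 1) $ i $ j" for i j
  proof -
    have bd: "lev i \<le> N" "lev j \<le> N"
      using range by (metis atLeastAtMost_iff rangeI)+
    consider "lev i = lev j" | "lev i < lev j" | "lev j < lev i" by linarith
    then show ?thesis
      using lower[of "lev j" "lev i"] upper[of "lev i" "lev j"] diag[of "lev i"] bd inj
      by cases (auto simp: cscale_def mat_def dest: injD)
  qed
  then show ?thesis unfolding vec_eq_iff by blast
qed

section \<open>The Sylvester equation and its solution \<open>G_Bures\<close>\<close>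

definition sylvester :: "complex^'n^'n \<Rightarrow> complex^'n^'n \<Rightarrow> complex^'n^'n"
  where "sylvester \<sigma> G = \<sigma> ** G + G ** \<sigma>"

lemma linear_sylvester: "linear (sylvester \<sigma>)"
  by (rule linearI) (simp_all add: sylvester_def matrix_mul_expand algebra_simps)

text \<open>Coercivity of the Sylvester operator in the Hilbert-Schmidt pairing: for positive
  definite \<open>\<sigma>\<close> the right side is positive unless \<open>G = 0\<close>, which
  yields injectivity below.\<close>

lemma weighted_form_sylvester:
  "Re (trace (dagger G ** sylvester \<sigma> G)) = weighted_form \<sigma> G + weighted_form \<sigma> (dagger G)"
  by (simp add: weighted_form_def sylvester_def matrix_mul_expand trace_expand dagger_expand
      trace_mul_sym[of "dagger G"] trace_mul_sym[of G])

lemma bij_sylvester: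
  assumes "pos_def \<sigma>"
  shows "bij (sylvester \<sigma>)"
proof -
  have "G = 0" if "sylvester \<sigma> G = 0" for G
  proof -
    have "weighted_form \<sigma> G + weighted_form \<sigma> (dagger G) = 0"
      using that by (simp add: trace_expand flip: weighted_form_sylvester)
    with weighted_form_nonneg[OF assms, of G] weighted_form_nonneg[OF assms, of "dagger G"]
    show ?thesis by (intro weighted_form_eq_0[OF assms]) linarith
  qed
  then have "inj (sylvester \<sigma>)"
    by (simp add: linear_injective_0[OF linear_sylvester])
  then show ?thesis
    by (simp add: bij_def linear_injective_imp_surjective[OF linear_sylvester])
qed

text \<open>Replaces the definite description by a linear inverse, so that \<open>G_Bures\<close> is
  affine in \<open>\<rho>\<close> and can be differentiated along solutions.\<close>

lemma G_Bures_eq: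
  assumes "pos_def \<sigma>"
  shows "G_Bures \<sigma> \<rho> = inv (sylvester \<sigma>) (\<rho> - \<sigma>)"
  unfolding G_Bures_def using bij_sylvester[OF assms]
  by (intro the_equality) (auto simp: sylvester_def[symmetric] bij_is_surj surj_f_inv_f
      bij_is_inj inv_f_eq)

lemma sylvester_G_Bures:
  assumes "pos_def \<sigma>"
  shows "sylvester \<sigma> (G_Bures \<sigma> \<rho>) = \<rho> - \<sigma>"
  by (simp add: G_Bures_eq[OF assms] bij_is_surj[OF bij_sylvester[OF assms]] surj_f_inv_f)

text \<open>Taking adjoints in the Sylvester equation shows that \<open>dagger G\<close> solves it
  as well; uniqueness concludes.\<close>

lemma dagger_G_Bures:
  assumes "pos_def \<sigma>" and "dagger \<rho> = \<rho>"
  shows "dagger (G_Bures \<sigma> \<rho>) = G_Bures \<sigma> \<rho>"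
proof -
  have "dagger \<sigma> = \<sigma>"
    using assms(1) by (simp add: pos_def_def self_adjoint_def)
  then have "sylvester \<sigma> (dagger G) = dagger (sylvester \<sigma> G)" for G
    by (simp add: sylvester_def dagger_expand add.commute)
  then have "sylvester \<sigma> (dagger (G_Bures \<sigma> \<rho>)) = sylvester \<sigma> (G_Bures \<sigma> \<rho>)"
    using assms \<open>dagger \<sigma> = \<sigma>\<close> by (simp add: sylvester_G_Bures dagger_expand)
  then show ?thesis
    using bij_sylvester[OF assms(1)] by (simp add: bij_is_inj inj_eq)
qed

lemma V_Bures_weighted_form:
  assumes "pos_def \<sigma>" and "dagger \<rho> = \<rho>"
  shows "V_Bures \<sigma> \<rho> = weighted_form \<sigma> (G_Bures \<sigma> \<rho>)"
  by (simp add: V_Bures_def weighted_form_def dagger_G_Bures[OF assms])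

lemma G_Bures_eq_0_iff:
  assumes "pos_def \<sigma>"
  shows "G_Bures \<sigma> \<rho> = 0 \<longleftrightarrow> \<rho> = \<sigma>"
  using sylvester_G_Bures[OF assms, of \<rho>] bij_is_inj[OF bij_sylvester[OF assms]]
  by (metis eq_iff_diff_eq_0 inj_eq linear_0 linear_sylvester)

lemma has_vector_derivative_G_Bures:
  assumes "pos_def \<sigma>" and "(\<rho> has_vector_derivative \<rho>') F"
  shows "((\<lambda>s. G_Bures \<sigma> (\<rho> s)) has_vector_derivative inv (sylvester \<sigma>) \<rho>') F"
proof -
  have "linear (inv (sylvester \<sigma>))"
    using bij_sylvester[OF assms(1)] linear_sylvester
    by (metis bij_is_inj inj_linear_imp_inv_linear)
  then have "bounded_linear (inv (sylvester \<sigma>))"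
    by (simp add: linear_conv_bounded_linear)
  moreover have "((\<lambda>s. \<rho> s - \<sigma>) has_vector_derivative \<rho>') F"
    using assms(2) by (auto intro!: derivative_eq_intros)
  ultimately show ?thesis
    unfolding G_Bures_eq[OF assms(1)] by (rule bounded_linear.has_vector_derivative)
qed

section \<open>The dissipation and its kernel\<close>

text \<open>The rate at which the Bures functional decreases along a solution, as a function of
  \<open>G\<close>; see \<open>V_Bures_has_derivative\<close>.\<close>

definition dissipation :: "'k set \<Rightarrow> ('k \<Rightarrow> complex^'n^'n) \<Rightarrow> complex^'n^'n \<Rightarrow> complex^'n^'n \<Rightarrow> real"
  where "dissipation K L \<sigma> G = (\<Sum>k\<in>K. weighted_form \<sigma> (commutator (L k) G))"

lemma dissipation_scaleR:
  fixes G :: "complex^'n^'n"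
  shows "dissipation K L \<sigma> (r *\<^sub>R G) = r\<^sup>2 * dissipation K L \<sigma> G"
proof -
  have "commutator A (r *\<^sub>R G) = r *\<^sub>R commutator A G" for A :: "complex^'n^'n"
    by (simp add: commutator_def matrix_mul_expand algebra_simps)
  then show ?thesis
    by (simp add: dissipation_def weighted_form_scaleR sum_distrib_left)
qed

lemma continuous_on_dissipation:
  fixes \<sigma> :: "complex^'n^'n"
  shows "continuous_on UNIV (dissipation K L \<sigma>)"
proof -
  have "linear (commutator A)" for A :: "complex^'n^'n"
    by (rule linearI) (simp_all add: commutator_def matrix_mul_expand algebra_simps)
  then have "continuous_on UNIV (commutator A)" for A :: "complex^'n^'n"
    by (simp add: linear_continuous_on linear_conv_bounded_linear)
  then show ?thesis
    unfolding dissipation_def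
    by (intro continuous_on_sum continuous_on_compose2[OF continuous_on_weighted_form]) auto
qed

lemma dissipation_nonneg: "pos_def \<sigma> \<Longrightarrow> dissipation K L \<sigma> G \<ge> 0"
  unfolding dissipation_def by (intro sum_nonneg weighted_form_nonneg)

text \<open>A vanishing sum of nonnegative terms vanishes termwise, so the single operator
  \<open>L k\<close> already forces \<open>G\<close> to be a multiple \<open>d\<close> of the
  identity; the trace condition then reads \<open>d = 0\<close>.\<close>

lemma dissipation_eq_0:
  assumes lev: "bij_betw lev UNIV {0..N}" and "finite K"
    and k: "k \<in> K" "c \<noteq> 0" "L k = cscale c (annihilation lev N)"
    and \<sigma>: "pos_def \<sigma>" "trace \<sigma> = 1"
    and G: "dagger G = G" "trace (\<sigma> ** G) = 0" "dissipation K L \<sigma> G = 0"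
  shows "G = 0"
proof -
  have "weighted_form \<sigma> (commutator (L k) G) = 0"
    using G(3) k(1) \<open>finite K\<close> weighted_form_nonneg[OF \<sigma>(1)]
    by (simp add: dissipation_def sum_nonneg_eq_0_iff)
  then have "commutator (L k) G = 0"
    by (rule weighted_form_eq_0[OF \<sigma>(1)])
  then have "commutator (annihilation lev N) G = 0"
    using k by (simp add: commutator_cscale_left cscale_eq_0_iff)
  then obtain d where d: "G = cscale d (mat 1)"
    using commutes_annihilation_imp_scalar[OF lev _ G(1)] by blast
  then show ?thesis
    using G(2) \<sigma>(2) by (simp add: matrix_mul_expand trace_expand cscale_eq_0_iff)
qed

section \<open>Self-adjointness and trace along solutions\<close>

lemma density_operator_dagger: "density_operator \<rho> \<Longrightarrow> dagger \<rho> = \<rho>"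
  by (simp add: density_operator_def pos_semidef_def self_adjoint_def)

text \<open>The generator commutes with \<open>dagger\<close>, so the difference \<open>Y\<close> of
  \<open>\<rho>\<close> and its adjoint solves the same linear equation with initial value 0.
  Gronwall applied to the squared norm of \<open>Y\<close> keeps it 0.\<close>

lemma density_solution_dagger:
  fixes \<rho> :: "real \<Rightarrow> complex^'n^'n"
  assumes "self_adjoint H" and sol: "density_solution (lindblad H K L) \<rho>" and "t \<ge> 0"
  shows "dagger (\<rho> t) = \<rho> t"
proof -
  let ?F = "lindblad H K L"
  define Y where "Y s = \<rho> s - dagger (\<rho> s)" for s
  have lin: "bounded_linear ?F" "bounded_linear (dagger :: complex^'n^'n \<Rightarrow> _)"
    by (simp_all add: linear_conv_bounded_linear[symmetric] linear_lindblad linear_dagger)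
  have Y': "(Y has_vector_derivative ?F (Y s)) (at s within {0..})" if "s \<ge> 0" for s
  proof -
    have "(\<rho> has_vector_derivative ?F (\<rho> s)) (at s within {0..})"
      using sol that by (simp add: density_solution_def)
    from has_vector_derivative_diff[OF this bounded_linear.has_vector_derivative[OF lin(2) this]]
    show ?thesis
      by (simp add: Y_def[abs_def] linear_diff[OF linear_lindblad] lindblad_dagger[OF assms(1)])
  qed
  obtain B where B: "\<And>X. norm (?F X) \<le> norm X * B"
    using bounded_linear.bounded[OF lin(1)] by blast
  have "\<exists>D. ((\<lambda>s. Y s \<bullet> Y s) has_real_derivative D) (at s within {0..}) \<and> D \<le> 2 * B * (Y s \<bullet> Y s)"
    if "s \<ge> 0" for s
  proof (intro exI conjI)
    show "((\<lambda>s. Y s \<bullet> Y s) has_real_derivative 2 * (Y s \<bullet> ?F (Y s))) (at s within {0..})"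
      using bounded_bilinear.has_vector_derivative[OF bounded_bilinear_inner Y'[OF that] Y'[OF that]]
      by (simp add: has_real_derivative_iff_has_vector_derivative inner_commute)
    have "Y s \<bullet> ?F (Y s) \<le> norm (Y s) * norm (?F (Y s))"
      by (rule norm_cauchy_schwarz)
    also have "\<dots> \<le> norm (Y s) * (norm (Y s) * B)"
      by (intro mult_left_mono B) simp
    finally show "2 * (Y s \<bullet> ?F (Y s)) \<le> 2 * B * (Y s \<bullet> Y s)"
      by (simp add: dot_square_norm power2_eq_square mult_ac)
  qed
  then have "Y t \<bullet> Y t \<le> (Y 0 \<bullet> Y 0) * exp (2 * B * t)"
    using \<open>t \<ge> 0\<close> by (rule gronwall_exp_bound)
  moreover have "Y 0 = 0"
    using sol density_operator_dagger[of "\<rho> 0"] by (simp add: Y_def density_solution_def)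
  ultimately have "Y t = 0"
    by (metis inner_eq_zero_iff inner_ge_zero inner_zero_left mult_zero_left order_antisym)
  then show ?thesis by (simp add: Y_def)
qed

lemma density_solution_trace:
  fixes \<rho> :: "real \<Rightarrow> complex^'n^'n"
  assumes sol: "density_solution (lindblad H K L) \<rho>" and "t \<ge> 0"
  shows "trace (\<rho> t) = 1"
proof -
  have lin: "bounded_linear (trace :: complex^'n^'n \<Rightarrow> _)"
    by (simp add: linear_conv_bounded_linear[symmetric] linear_trace)
  have "((\<lambda>s. trace (\<rho> s)) has_vector_derivative 0) (at s within {0..})" if "s \<in> {0..}" for s
    using bounded_linear.has_vector_derivative[OF lin] sol that
    by (metis atLeast_iff density_solution_def trace_lindblad)
  then obtain c where "\<And>s. s \<in> {0..} \<Longrightarrow> trace (\<rho> s) = c"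
    using has_vector_derivative_zero_constant[OF convex_real_interval(1)] by blast
  moreover have "trace (\<rho> 0) = 1"
    using sol by (simp add: density_solution_def density_operator_def)
  ultimately show ?thesis
    using \<open>t \<ge> 0\<close> by force
qed

section \<open>The derivative of the Bures functional\<close>

lemma trace_G_Bures:
  assumes "pos_def \<sigma>" and "trace \<rho> = trace \<sigma>"
  shows "trace (\<sigma> ** G_Bures \<sigma> \<rho>) = 0"
proof -
  have "2 * trace (\<sigma> ** G_Bures \<sigma> \<rho>) = trace (sylvester \<sigma> (G_Bures \<sigma> \<rho>))"
    by (simp add: sylvester_def trace_expand trace_mul_sym[of "G_Bures \<sigma> \<rho>"])
  then show ?thesis
    using assms by (simp add: sylvester_G_Bures trace_expand)
qed

lemma V_Bures_has_derivative:
  assumes "pos_def \<sigma>" and eq: "lindblad H K L \<sigma> = 0"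
    and \<rho>: "(\<rho> has_vector_derivative lindblad H K L (\<rho> t)) (at t within S)" "dagger (\<rho> t) = \<rho> t"
  shows "((\<lambda>s. V_Bures \<sigma> (\<rho> s)) has_real_derivative - dissipation K L \<sigma> (G_Bures \<sigma> (\<rho> t)))
    (at t within S)"
proof -
  let ?F = "lindblad H K L"
  define G where "G s = G_Bures \<sigma> (\<rho> s)" for s
  define G' where "G' = inv (sylvester \<sigma>) (?F (\<rho> t))"
  have G': "(G has_vector_derivative G') (at t within S)"
    unfolding G_def[abs_def] G'_def by (rule has_vector_derivative_G_Bures[OF assms(1) \<rho>(1)])
  have "linear (\<lambda>A. Re (trace (\<sigma> ** A)))"
    by (rule linearI) (simp_all add: matrix_mul_expand trace_expand)
  then have lin: "bounded_linear (\<lambda>A. Re (trace (\<sigma> ** A)))"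
    by (simp add: linear_conv_bounded_linear)
  have "((\<lambda>s. Re (trace (\<sigma> ** (G s ** G s)))) has_vector_derivative
      Re (trace (\<sigma> ** (G t ** G' + G' ** G t)))) (at t within S)"
    by (intro bounded_linear.has_vector_derivative[OF lin]
        bounded_bilinear.has_vector_derivative[OF bounded_bilinear_matrix_mul] G')
  moreover have "Re (trace (\<sigma> ** (G t ** G' + G' ** G t))) = - dissipation K L \<sigma> (G t)"
  proof -
    \<comment> \<open>Cyclicity moves the symmetrized product onto \<open>G'\<close>, where the
      Sylvester operator cancels its inverse; no formula for the inverse is required.\<close>
    have "trace (\<sigma> ** (G t ** G' + G' ** G t)) = trace (G t ** sylvester \<sigma> G')"
      by (simp add: sylvester_def matrix_mul_expand trace_expand trace_mul_sym[of "G t"]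
          trace_mul_sym[of G'])
    \<comment> \<open>Subtracting \<open>\<sigma>\<close> is free because the generator annihilates
      it.\<close>
    also have "sylvester \<sigma> G' = ?F (\<rho> t - \<sigma>)"
      using bij_sylvester[OF assms(1)] eq
      by (simp add: G'_def bij_is_surj surj_f_inv_f linear_diff[OF linear_lindblad])
    also have "\<rho> t - \<sigma> = \<sigma> ** G t + G t ** \<sigma>"
      using sylvester_G_Bures[OF assms(1)] by (simp add: G_def sylvester_def)
    \<comment> \<open>In the carre du champ identity the term with the square of \<open>G\<close>
      contains the generator at \<open>\<sigma>\<close> and vanishes by equilibrium.\<close>
    also have "trace (G t ** ?F (\<sigma> ** G t + G t ** \<sigma>))
        = - (\<Sum>k\<in>K. trace (\<sigma> ** (dagger (commutator (L k) (G t)) ** commutator (L k) (G t))))"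
      using lindblad_carre_du_champ[of "G t" H K L \<sigma>] dagger_G_Bures[OF assms(1) \<rho>(2)] eq
      by (simp add: G_def trace_expand)
    finally show ?thesis
      by (simp add: dissipation_def weighted_form_def)
  qed
  ultimately show ?thesis
    by (simp add: V_Bures_def has_real_derivative_iff_has_vector_derivative G_def)
qed

section \<open>Strict decrease and exponential convergence\<close>

theorem theoremV5:
  fixes N :: nat
    and lev :: "'n::finite \<Rightarrow> nat"
    and H :: "complex^'n^'n"
    and K :: "'k set"
    and L :: "'k \<Rightarrow> complex^'n^'n"
    and \<rho>_inf :: "complex^'n^'n"
  assumes "N > 0"
    and "bij_betw lev UNIV {0..N}"
    and "self_adjoint H"
    and "finite K"
    and "\<exists>k\<in>K. \<exists>c. c \<noteq> 0 \<and> L k = cscale c (annihilation lev N)"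
    and "density_operator \<rho>_inf"
    and "pos_def \<rho>_inf"
    and "lindblad H K L \<rho>_inf = 0"
  shows "strict_lyapunov (lindblad H K L) \<rho>_inf (V_Bures \<rho>_inf) \<and>
    (\<forall>\<rho>. density_solution (lindblad H K L) \<rho> \<longrightarrow> (\<rho> \<longlongrightarrow> \<rho>_inf) at_top)"
proof (intro conjI allI impI)
  let ?F = "lindblad H K L" and ?\<sigma> = \<rho>_inf
  let ?G = "G_Bures ?\<sigma>" and ?D = "dissipation K L ?\<sigma>"
  note pd = \<open>pos_def ?\<sigma>\<close>
  obtain k c where k: "k \<in> K" "c \<noteq> 0" "L k = cscale c (annihilation lev N)"
    using assms(5) by blast
  have tr1: "trace ?\<sigma> = 1"
    using assms(6) by (simp add: density_operator_def)
  \<comment> \<open>A real subspace that contains \<open>G\<close> along every solution and on which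
    the dissipation is positive definite.\<close>
  define E where "E = {G :: complex^'n^'n. dagger G = G \<and> trace (?\<sigma> ** G) = 0}"
  have E: "subspace E"
    by (simp add: subspace_def E_def dagger_expand matrix_mul_expand trace_expand)
  have D_pos: "?D G > 0" if "G \<in> E" "G \<noteq> 0" for G
    using that dissipation_eq_0[where L = L and k = k, OF assms(2,4) k pd tr1, of G]
      dissipation_nonneg[OF pd, of K L G]
    by (auto simp: E_def less_le)
  have V_eq: "V_Bures ?\<sigma> \<rho> = weighted_form ?\<sigma> (?G \<rho>)" if "dagger \<rho> = \<rho>" for \<rho>
    by (rule V_Bures_weighted_form[OF pd that])

  have sol_dagger: "dagger (\<rho> t) = \<rho> t" if "density_solution ?F \<rho>" "t \<ge> 0" for \<rho> t
    by (rule density_solution_dagger[OF assms(3) that])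
  have G_in_E: "?G (\<rho> t) \<in> E" if "density_solution ?F \<rho>" "t \<ge> 0" for \<rho> t
    using sol_dagger[OF that] density_solution_trace[OF that] tr1
    by (simp add: E_def dagger_G_Bures[OF pd] trace_G_Bures[OF pd])
  have V_deriv: "((\<lambda>s. V_Bures ?\<sigma> (\<rho> s)) has_real_derivative - ?D (?G (\<rho> t))) (at t within {0..})"
    if "density_solution ?F \<rho>" "t \<ge> 0" for \<rho> t
    using that sol_dagger[OF that] V_Bures_has_derivative[OF pd assms(8)]
    by (simp add: density_solution_def)

  show "strict_lyapunov ?F ?\<sigma> (V_Bures ?\<sigma>)"
    unfolding strict_lyapunov_def
  proof (intro conjI allI impI)
    fix \<rho> :: "complex^'n^'n"
    assume "density_operator \<rho>"
    then have V: "V_Bures ?\<sigma> \<rho> = weighted_form ?\<sigma> (?G \<rho>)"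
      by (intro V_eq density_operator_dagger)
    then show "V_Bures ?\<sigma> \<rho> \<ge> 0"
      by (simp add: weighted_form_nonneg[OF pd])
    show "V_Bures ?\<sigma> \<rho> = 0 \<longleftrightarrow> \<rho> = ?\<sigma>"
      using weighted_form_eq_0[OF pd] weighted_form_0 unfolding V
      by (metis G_Bures_eq_0_iff[OF pd])
  next
    fix \<rho> :: "real \<Rightarrow> complex^'n^'n" and t :: real
    assume sol: "density_solution ?F \<rho>" "t \<ge> 0"
    have "?D 0 = 0"
      using dissipation_scaleR[of K L ?\<sigma> 0 0] by simp
    then have "?D (?G (\<rho> t)) = 0 \<longleftrightarrow> \<rho> t = ?\<sigma>"
      using D_pos[OF G_in_E[OF sol]] G_Bures_eq_0_iff[OF pd] by (metis less_irrefl)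
    then show "\<exists>D. ((\<lambda>s. V_Bures ?\<sigma> (\<rho> s)) has_real_derivative D) (at t within {0..}) \<and>
        D \<le> 0 \<and> (D = 0 \<longleftrightarrow> \<rho> t = ?\<sigma>)"
      using V_deriv[OF sol] dissipation_nonneg[OF pd, of K L "?G (\<rho> t)"]
      by (intro exI[of _ "- ?D (?G (\<rho> t))"]) auto
  qed

  fix \<rho> :: "real \<Rightarrow> complex^'n^'n"
  assume sol: "density_solution ?F \<rho>"
  \<comment> \<open>Compactness on the unit sphere of \<open>E\<close> bounds the functional by
    \<open>C\<close> times the dissipation, which gives decay at rate \<open>1 / C\<close>.\<close>
  obtain C where C: "C > 0" "\<And>G. G \<in> E \<Longrightarrow> weighted_form ?\<sigma> G \<le> C * ?D G"
    using square_homogeneous_bound[OF E continuous_on_dissipation continuous_on_weighted_form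
        dissipation_scaleR weighted_form_scaleR D_pos] by blast
  have norm_hom: "(norm (r *\<^sub>R G))\<^sup>2 = r\<^sup>2 * (norm G)\<^sup>2" for r and G :: "complex^'n^'n"
    by (simp add: power_mult_distrib)
  have weighted_pos: "weighted_form ?\<sigma> G > 0" if "G \<noteq> 0" for G
    using that weighted_form_nonneg[OF pd, of G] weighted_form_eq_0[OF pd, of G]
    by (auto simp: less_le)
  \<comment> \<open>The same comparison on the whole matrix space, to turn decay of the functional
    into decay of the norm of \<open>G\<close>.\<close>
  obtain B where B: "B > 0" "\<And>G. (norm G)\<^sup>2 \<le> B * weighted_form ?\<sigma> G"
  proof (rule square_homogeneous_bound[OF subspace_UNIV continuous_on_weighted_form _
        weighted_form_scaleR norm_hom weighted_pos])
    show "continuous_on UNIV (\<lambda>G :: complex^'n^'n. (norm G)\<^sup>2)"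
      by (intro continuous_intros)
  qed auto
  define v where "v s = V_Bures ?\<sigma> (\<rho> s)" for s
  have v: "v s = weighted_form ?\<sigma> (?G (\<rho> s))" if "s \<ge> 0" for s
    unfolding v_def by (rule V_eq[OF sol_dagger[OF sol that]])
  have decay: "v t \<le> v 0 * exp (- (1 / C) * t)" if "t \<ge> 0" for t
  proof (rule gronwall_exp_bound[OF _ that])
    fix s :: real
    assume "s \<ge> 0"
    have "- ?D (?G (\<rho> s)) \<le> - (1 / C) * v s"
      using C(2)[OF G_in_E[OF sol \<open>s \<ge> 0\<close>]] C(1) by (simp add: v[OF \<open>s \<ge> 0\<close>] field_simps)
    then show "\<exists>D. (v has_real_derivative D) (at s within {0..}) \<and> D \<le> - (1 / C) * v s"
      using V_deriv[OF sol \<open>s \<ge> 0\<close>] unfolding v_def by blast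
  qed
  have "((\<lambda>t. (norm (?G (\<rho> t)))\<^sup>2) \<longlongrightarrow> 0) at_top"
  proof (rule tendsto_sandwich[where f = "\<lambda>_. 0"])
    show "\<forall>\<^sub>F t in at_top. (norm (?G (\<rho> t)))\<^sup>2 \<le> B * (v 0 * exp (- (1 / C) * t))"
    proof (rule eventually_at_top_linorderI[of 0])
      fix t :: real
      assume "t \<ge> 0"
      have "(norm (?G (\<rho> t)))\<^sup>2 \<le> B * v t"
        using B(2) by (simp add: v[OF \<open>t \<ge> 0\<close>])
      also have "\<dots> \<le> B * (v 0 * exp (- (1 / C) * t))"
        using B(1) by (intro mult_left_mono decay[OF \<open>t \<ge> 0\<close>]) simp
      finally show "(norm (?G (\<rho> t)))\<^sup>2 \<le> B * (v 0 * exp (- (1 / C) * t))" .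
    qed
    have "((\<lambda>t. exp (- (1 / C) * t)) \<longlongrightarrow> 0) at_top"
      using C(1) by (intro filterlim_compose[OF exp_at_bot]
          filterlim_tendsto_neg_mult_at_bot[OF tendsto_const] filterlim_ident) auto
    then show "((\<lambda>t. B * (v 0 * exp (- (1 / C) * t))) \<longlongrightarrow> 0) at_top"
      by (rule tendsto_mult_right_zero[OF tendsto_mult_right_zero])
  qed simp_all
  from tendsto_real_sqrt[OF this] have "((\<lambda>t. norm (?G (\<rho> t))) \<longlongrightarrow> 0) at_top"
    by simp
  then have "((\<lambda>t. ?G (\<rho> t)) \<longlongrightarrow> 0) at_top"
    by (rule tendsto_norm_zero_cancel)
  \<comment> \<open>Continuity of the Sylvester operator carries the limit from \<open>G\<close>
    back to the difference of \<open>\<rho>\<close> and the equilibrium.\<close>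
  then have "((\<lambda>t. sylvester ?\<sigma> (?G (\<rho> t))) \<longlongrightarrow> 0) at_top"
    by (rule bounded_linear.tendsto_zero[OF linear_sylvester[unfolded linear_conv_bounded_linear]])
  then show "(\<rho> \<longlongrightarrow> ?\<sigma>) at_top"
    unfolding sylvester_G_Bures[OF pd] by (rule LIM_zero_cancel)
qed

end
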